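(* For an integer $d$, let $k=\left\lceil \frac{\log_2 1.5}{\log_2 4.5}(d-1)\right\rceil$ and $m=d-1-2k$. Let $D_0$ be the distribution on $Q^{2k+1}$ with $2^k$ pebbles on each of $\mathbf{0}^{2k+1}$ and $\mathbf{1}^{2k+1}$ and none elsewhere, and for $i\ge0$ let $D_{i+1}$ be the distribution on $Q^{2k+i+2}$ given by $D_{i+1}(\mathbf{v}\cdot0)=E_{D_i(\mathbf{v})}(x_0)$, $D_{i+1}(\mathbf{v}\cdot1)=E_{D_i(\mathbf{v})}(x_1)$ for $\mathbf{v}\in V(Q^{2k+i+1})$. Then the distribution $D_m$ on $Q^{2k+m+1}=Q^d$ satisfies, as $d\to\infty$, $|D_m|\in O(2^m)$, and $2^m\in O(c^d)$ where $c=2^{1/\log_2 4.5}\approx1.3763$.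
   Context: A distribution on a graph $G=(V,E)$ is a function $D:V\to\mathbb{N}$, with size $|D|=\sum_v D(v)$. The hypercube $Q^n$ has vertex set $\{0,1\}^n$ (bitstrings of length $n$), two bitstrings adjacent iff they differ in exactly one bit; $\mathbf{0}^n,\mathbf{1}^n$ are the all-zeros and all-ones strings and $\mathbf{v}\cdot b$ is the concatenation of $\mathbf{v}$ with the bit $b$. With $K_2$ having vertices $x_0,x_1$, for integers $j\ge0$ the distributions $E_r$ on $K_2$ are: $E_{3j}(x_0)=E_{3j}(x_1)=2j$; $E_{3j+1}(x_0)=2j+2$, $E_{3j+1}(x_1)=2j$; $E_{3j+2}(x_0)=2j+2$, $E_{3j+2}(x_1)=2j+1$. (For $d$ large, $m\ge0$.) *)

theory Defs
  imports Complex_Main "HOL-Library.Landau_Symbols"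
begin

(* A graph is a pair (vertex set, set of edges), an edge being a two-element set of vertices. *)
type_synonym 'a graph = "'a set \<times> 'a set set"

abbreviation verts :: "'a graph \<Rightarrow> 'a set" where
  "verts G \<equiv> fst G"

(* A distribution on G is a map from the vertices of G to nat. It is represented by a total
   function; only its values on verts G are meaningful. *)
type_synonym 'a distribution = "'a \<Rightarrow> nat"

definition dist_size :: "'a graph \<Rightarrow> 'a distribution \<Rightarrow> nat" where
  "dist_size G D = (\<Sum>v\<in>verts G. D v)"

(* Bitstrings are lists of booleans: the bit 0 is False, the bit 1 is True. *)
definition hypercube :: "nat \<Rightarrow> bool list graph" where
  "hypercube n =
    ({v. length v = n},
     {{u, v} | u v. length u = n \<and> length v = n \<and> card {i. i < n \<and> u ! i \<noteq> v ! i} = 1})"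

(* The distributions E_r on K_2, with x_0 = False and x_1 = True. *)
definition E :: "nat \<Rightarrow> bool distribution" where
  "E r = (let j = r div 3 in
     if r mod 3 = 0 then (\<lambda>x. 2 * j)
     else if r mod 3 = 1 then (\<lambda>x. if x then 2 * j else 2 * j + 2)
     else (\<lambda>x. if x then 2 * j + 1 else 2 * j + 2))"

lemma E_simps:
  "E (3 * j) False = 2 * j" "E (3 * j) True = 2 * j"
  "E (3 * j + 1) False = 2 * j + 2" "E (3 * j + 1) True = 2 * j"
  "E (3 * j + 2) False = 2 * j + 2" "E (3 * j + 2) True = 2 * j + 1"
proof -
  have "(3 * j + 1) mod 3 = 1" "(3 * j + 1) div 3 = j"
    "(3 * j + 2) mod 3 = 2" "(3 * j + 2) div 3 = j"
    by presburger+
  then show "E (3 * j) False = 2 * j" "E (3 * j) True = 2 * j"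
    "E (3 * j + 1) False = 2 * j + 2" "E (3 * j + 1) True = 2 * j"
    "E (3 * j + 2) False = 2 * j + 2" "E (3 * j + 2) True = 2 * j + 1"
    by (simp_all only: E_def Let_def) simp_all
qed

(* D k i is the distribution D_i on the hypercube of dimension 2k+i+1. *)
primrec D :: "nat \<Rightarrow> nat \<Rightarrow> bool list distribution" where
  "D k 0 = (\<lambda>v. if v = replicate (2 * k + 1) False \<or> v = replicate (2 * k + 1) True
                then 2 ^ k else 0)"
| "D k (Suc i) = (\<lambda>w. E (D k i (butlast w)) (last w))"

lemma D_Suc_append: "D k (Suc i) (v @ [b]) = E (D k i v) b"
  by simp

(* The ceiling is nonnegative for every natural number d (for d = 0 it is 0), so nat
   does not truncate. *)
definition kpar :: "nat \<Rightarrow> nat" where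
  "kpar d = nat \<lceil>log 2 (3/2) / log 2 (9/2) * (real d - 1)\<rceil>"

(* An integer, since it is negative for some small d, e.g. for d = 2. *)
definition mpar :: "nat \<Rightarrow> int" where
  "mpar d = int d - 1 - 2 * int (kpar d)"

definition c :: real where
  "c = 2 powr (1 / log 2 (9/2))"

end

theory Submission
  imports Defs
begin

text \<open>Each \<open>E\<^sub>r\<close> has at most \<open>(4r + 2) / 3\<close> pebbles, and none if \<open>r = 0\<close>. So if \<open>s\<^sub>i\<close> is the
  size of \<open>D\<^sub>i\<close> and \<open>n\<^sub>i\<close> the number of its occupied vertices, then \<open>3 s\<^sub>i\<^sub>+\<^sub>1 \<le> 4 s\<^sub>i + 2 n\<^sub>i\<close> and
  \<open>n\<^sub>i \<le> 2\<^sup>i\<^sup>+\<^sup>1\<close>, whence \<open>s\<^sub>i \<le> 2 (4/3)\<^sup>i 2\<^sup>k + 2 2\<^sup>i\<close>. The parameter \<open>k\<close> is chosen such that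
  \<open>2\<^sup>k = O((3/2)\<^sup>m)\<close>, which makes both summands \<open>O(2\<^sup>m)\<close>.\<close>

lemma E_0: "E 0 b = 0"
  by (simp add: E_def Let_def)

text \<open>Residue 1 modulo 3 gives equality, the other two leave slack. The factor
  \<open>of_bool\<close> keeps empty vertices free of charge, so the error is counted over the
  support and not over the whole cube.\<close>

lemma E_size_le: "3 * (E r False + E r True) \<le> 4 * r + 2 * of_bool (r > 0)"
proof -
  have "r = 3 * (r div 3) + r mod 3" by simp
  moreover have "r mod 3 < 3" by simp
  ultimately consider j where "r = 3 * j" | j where "r = 3 * j + 1" | j where "r = 3 * j + 2"
    by (metis add_0_right less_Suc_eq less_one numeral_3_eq_3 numeral_2_eq_2 One_nat_def not_less0)
  then show ?thesis
    by cases (simp_all only: E_simps, simp_all)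
qed

section \<open>Summation over bitstrings\<close>

lemma finite_bitstrings: "finite {v :: bool list. length v = n}"
  using finite_lists_length_eq[of "UNIV :: bool set" n] by simp

lemma bitstrings_Suc:
  "{w :: bool list. length w = Suc n} = (\<lambda>(v, b). v @ [b]) ` ({v. length v = n} \<times> UNIV)"
  by (auto simp: length_Suc_conv_rev image_iff)

lemma inj_on_snoc: "inj_on (\<lambda>(v, b). v @ [b]) A"
  by (auto simp: inj_on_def)

text \<open>Split by the last bit, since \<open>D\<close> appends the new coordinate at the
  end.\<close>

lemma sum_bitstrings_Suc:
  fixes f :: "bool list \<Rightarrow> 'a :: comm_monoid_add"
  shows "(\<Sum>w | length w = Suc n. f w) = (\<Sum>v | length v = n. f (v @ [False]) + f (v @ [True]))"
proof -
  have "(\<Sum>w | length w = Suc n. f w) = (\<Sum>x\<in>{v. length v = n} \<times> UNIV. f (fst x @ [snd x]))"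
    unfolding bitstrings_Suc by (subst sum.reindex[OF inj_on_snoc]) (simp add: case_prod_unfold)
  also have "\<dots> = (\<Sum>v | length v = n. \<Sum>b\<in>UNIV. f (v @ [b]))"
    by (simp add: sum.cartesian_product case_prod_unfold)
  finally show ?thesis
    by (simp add: UNIV_bool add.commute)
qed

section \<open>Support and size of \<open>D k i\<close>\<close>

definition occupied :: "nat \<Rightarrow> nat \<Rightarrow> nat" where
  "occupied k i = (\<Sum>v | length v = 2 * k + i + 1. of_bool (D k i v > 0))"

lemma dist_size_D_0: "dist_size (hypercube (2 * k + 1)) (D k 0) = 2 * 2 ^ k"
  and occupied_0: "occupied k 0 = 2"
proof -
  let ?V = "{v :: bool list. length v = 2 * k + 1}"
  let ?T = "{replicate (2 * k + 1) False, replicate (2 * k + 1) True}"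
  \<comment> \<open>The length \<open>2 * k + 1\<close> is positive, so the two strings in
    \<open>?T\<close> are distinct.\<close>
  have sub: "?T \<subseteq> ?V" by auto
  have "dist_size (hypercube (2 * k + 1)) (D k 0) = (\<Sum>v\<in>?T. D k 0 v)"
    unfolding dist_size_def hypercube_def fst_conv
    by (rule sum.mono_neutral_right[OF finite_bitstrings sub]) auto
  then show "dist_size (hypercube (2 * k + 1)) (D k 0) = 2 * 2 ^ k"
    by simp
  have "occupied k 0 = (\<Sum>v\<in>?T. of_bool (D k 0 v > 0))"
    unfolding occupied_def add_0_right
    by (rule sum.mono_neutral_right[OF finite_bitstrings sub]) auto
  then show "occupied k 0 = 2"
    by simp
qed

text \<open>An empty vertex has only empty copies, and an occupied one has at most two occupied
  copies.\<close>

lemma occupied_le: "occupied k i \<le> 2 * 2 ^ i"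
proof (induction i)
  case 0
  show ?case by (simp add: occupied_0)
next
  case (Suc i)
  have "occupied k (Suc i) = (\<Sum>v | length v = 2 * k + i + 1.
      of_bool (E (D k i v) False > 0) + of_bool (E (D k i v) True > 0))"
    using sum_bitstrings_Suc[of "\<lambda>w. of_bool (D k (Suc i) w > 0) :: nat" "2 * k + i + 1"]
    by (simp add: occupied_def)
  also have "\<dots> \<le> (\<Sum>v | length v = 2 * k + i + 1. 2 * of_bool (D k i v > 0))"
    by (rule sum_mono) (auto simp: of_bool_def E_0)
  also have "\<dots> = 2 * occupied k i"
    by (simp only: occupied_def sum_distrib_left)
  finally show ?case
    using Suc.IH by simp
qed

lemma dist_size_D_Suc:
  "3 * dist_size (hypercube (2 * k + Suc i + 1)) (D k (Suc i))
    \<le> 4 * dist_size (hypercube (2 * k + i + 1)) (D k i) + 2 * occupied k i"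
proof -
  have "3 * dist_size (hypercube (2 * k + Suc i + 1)) (D k (Suc i))
      = (\<Sum>v | length v = 2 * k + i + 1. 3 * (E (D k i v) False + E (D k i v) True))"
    using sum_bitstrings_Suc[of "D k (Suc i)" "2 * k + i + 1"]
    by (simp add: dist_size_def hypercube_def sum_distrib_left)
  also have "\<dots> \<le> (\<Sum>v | length v = 2 * k + i + 1. 4 * D k i v + 2 * of_bool (D k i v > 0))"
    by (rule sum_mono) (rule E_size_le)
  also have "\<dots> = 4 * dist_size (hypercube (2 * k + i + 1)) (D k i) + 2 * occupied k i"
    by (simp only: dist_size_def hypercube_def fst_conv occupied_def sum.distrib sum_distrib_left)
  finally show ?thesis .
qed

text \<open>The summand \<open>2 * 2 ^ i\<close> solves x' = 4/3 * x + 4/3 * \<open>2 ^ i\<close>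
  exactly; the other one is the homogeneous solution.\<close>

lemma dist_size_D_le:
  "real (dist_size (hypercube (2 * k + i + 1)) (D k i)) \<le> 2 * ((4 / 3) ^ i * 2 ^ k + 2 ^ i)"
proof (induction i)
  case 0
  show ?case using dist_size_D_0[of k] by simp
next
  case (Suc i)
  have "3 * dist_size (hypercube (2 * k + Suc i + 1)) (D k (Suc i))
      \<le> 4 * dist_size (hypercube (2 * k + i + 1)) (D k i) + 4 * 2 ^ i"
    using dist_size_D_Suc[of k i] occupied_le[of k i] by linarith
  then have "3 * real (dist_size (hypercube (2 * k + Suc i + 1)) (D k (Suc i)))
      \<le> 4 * real (dist_size (hypercube (2 * k + i + 1)) (D k i)) + 4 * 2 ^ i"
    by (simp only: of_nat_le_iff[where 'a = real, symmetric] of_nat_add of_nat_mult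
        of_nat_power of_nat_numeral)
  then show ?case using Suc.IH by simp
qed

section \<open>Bounds for k and m\<close>

abbreviation L :: real where
  "L \<equiv> log 2 (9/2)"

abbreviation \<beta> :: real where
  "\<beta> \<equiv> log 2 (3/2)"

text \<open>Since 9/2 = 2 * (3/2)^2. It gives 1 - 2 * \<open>\<beta> / L\<close> = 1 /
  \<open>L\<close>, so m is about (d - 1) / \<open>L\<close>.\<close>

lemma L_eq: "L = 1 + 2 * \<beta>"
proof -
  have "L = log 2 (2 * (3/2) ^ 2)" by (simp add: power2_eq_square)
  also have "\<dots> = 1 + 2 * \<beta>"
    by (subst log_mult) (simp_all add: log_nat_power del: power_divide)
  finally show ?thesis .
qed

lemma \<beta>_pos: "\<beta> > 0"
  by simp

lemma L_pos: "L > 0"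
  by simp

lemma kpar_bounds:
  assumes "d \<ge> 1"
  shows "real (kpar d) \<ge> \<beta> / L * (real d - 1)"
    and "real (kpar d) < \<beta> / L * (real d - 1) + 1"
proof -
  have "\<beta> / L * (real d - 1) \<ge> 0"
    using assms \<beta>_pos L_pos by (intro mult_nonneg_nonneg divide_nonneg_pos) auto
  then have "real (kpar d) = of_int \<lceil>\<beta> / L * (real d - 1)\<rceil>"
    unfolding kpar_def by simp
  then show "real (kpar d) \<ge> \<beta> / L * (real d - 1)"
    and "real (kpar d) < \<beta> / L * (real d - 1) + 1"
    by linarith+
qed

text \<open>Rounding k up adds less than 1 to it and so takes less than 2 from m.\<close>

lemma mpar_bounds:
  assumes "d \<ge> 1"
  shows "real_of_int (mpar d) \<le> (real d - 1) / L"
    and "real_of_int (mpar d) > (real d - 1) / L - 2"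
proof -
  have "(real d - 1) - 2 * (\<beta> / L * (real d - 1)) = (real d - 1) / L"
    using L_pos L_eq by (simp add: field_simps)
  moreover have "real_of_int (mpar d) = real d - 1 - 2 * real (kpar d)"
    unfolding mpar_def by simp
  ultimately show "real_of_int (mpar d) \<le> (real d - 1) / L"
    and "real_of_int (mpar d) > (real d - 1) / L - 2"
    using kpar_bounds[OF assms] by linarith+
qed

text \<open>Eliminates d between the upper bound for k and the lower bound for m.\<close>

lemma kpar_less: "d \<ge> 1 \<Longrightarrow> real (kpar d) < \<beta> * (real_of_int (mpar d) + 2) + 1"
proof -
  assume d: "d \<ge> 1"
  have "\<beta> * ((real d - 1) / L) < \<beta> * (real_of_int (mpar d) + 2)"
    using mpar_bounds(2)[OF d] \<beta>_pos by (intro mult_strict_left_mono) auto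
  then show ?thesis
    using kpar_bounds(2)[OF d] by simp
qed

lemma eventually_mpar_nonneg: "\<forall>\<^sub>F d in at_top. d \<ge> 1 \<and> mpar d \<ge> 0"
proof -
  have "\<forall>\<^sub>F d in at_top. real d \<ge> 2 * L + 1"
    using filterlim_real_sequentially by (simp add: filterlim_at_top)
  then show ?thesis
    using eventually_ge_at_top[of 1]
  proof eventually_elim
    case (elim d)
    then have "(real d - 1) / L \<ge> 2"
      using L_pos by (simp add: pos_le_divide_eq)
    then show ?case
      using mpar_bounds(2)[of d] elim by simp
  qed
qed

lemma kpar_mpar_dimension: "mpar d \<ge> 0 \<Longrightarrow> d \<ge> 1 \<Longrightarrow> 2 * kpar d + nat (mpar d) + 1 = d"
  unfolding mpar_def by linarith

lemma two_power_kpar_le: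
  assumes "d \<ge> 1" "mpar d \<ge> 0"
  shows "2 ^ kpar d \<le> (9 / 2 :: real) * (3 / 2) ^ nat (mpar d)"
proof -
  let ?m = "nat (mpar d)"
  have "(2::real) ^ kpar d = 2 powr real (kpar d)"
    by (simp add: powr_realpow)
  also have "\<dots> \<le> 2 powr (\<beta> * real (?m + 2) + 1)"
    using kpar_less[OF assms(1)] assms(2) by (intro powr_mono) (auto simp: add.commute)
  \<comment> \<open>As 2 to the power \<open>\<beta>\<close> is 3/2, the shifts by 2 and 1 produce
    the constant (3/2)^2 * 2 = 9/2.\<close>
  also have "\<dots> = (2 powr \<beta>) powr real (?m + 2) * 2"
    by (simp only: powr_add powr_powr powr_one_gt_zero_iff powr_one)
  also have "\<dots> = (3/2) ^ (?m + 2) * 2"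
    by (subst powr_realpow) simp_all
  also have "\<dots> = 9 / 2 * (3/2) ^ ?m"
    by (simp add: power_add power2_eq_square)
  finally show ?thesis .
qed

section \<open>Growth as d tends to infinity\<close>

lemma dist_size_D_bigo:
  "(\<lambda>d::nat. real (dist_size (hypercube d) (D (kpar d) (nat (mpar d)))))
    \<in> O(\<lambda>d. 2 powi (mpar d))"
\<comment> \<open>11 = 2 * 9/2 + 2, both summands being multiples of \<open>2 ^ m\<close> because
  4/3 * 3/2 = 2.\<close>
proof (rule bigoI[where c = 11])
  show "\<forall>\<^sub>F d in at_top. norm (real (dist_size (hypercube d) (D (kpar d) (nat (mpar d)))))
      \<le> 11 * norm (2 powi (mpar d) :: real)"
    using eventually_mpar_nonneg
  proof eventually_elim
    case (elim d)
    define m where "m = nat (mpar d)"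
    have m: "2 powi (mpar d) = (2::real) ^ m"
      using elim by (simp add: m_def power_int_def)
    have "real (dist_size (hypercube d) (D (kpar d) m)) \<le> 2 * ((4 / 3) ^ m * 2 ^ kpar d + 2 ^ m)"
      using dist_size_D_le[of "kpar d" m] kpar_mpar_dimension[of d] elim by (simp add: m_def)
    also have "\<dots> \<le> 2 * ((4 / 3) ^ m * (9 / 2 * (3 / 2) ^ m) + 2 ^ m)"
      using two_power_kpar_le[of d] elim by (simp add: m_def del: power_divide)
    also have "\<dots> = 9 * (4 / 3 * (3 / 2)) ^ m + 2 * 2 ^ m"
      by (simp only: power_mult_distrib) simp
    also have "\<dots> = 11 * 2 ^ m"
      by simp
    finally show ?case
      unfolding m by (simp add: m_def)
  qed
qed

lemma two_powi_mpar_bigo: "(\<lambda>d::nat. 2 powi (mpar d) :: real) \<in> O(\<lambda>d. c powr real d)"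
proof (rule bigoI[where c = 1])
  show "\<forall>\<^sub>F d in at_top. norm (2 powi (mpar d) :: real) \<le> 1 * norm (c powr real d)"
    using eventually_mpar_nonneg
  proof eventually_elim
    case (elim d)
    have "(2::real) powi (mpar d) = 2 powr real_of_int (mpar d)"
      by (simp add: powr_real_of_int')
    also have "\<dots> \<le> 2 powr (real d / L)"
      using mpar_bounds(1)[of d] elim L_pos
      by (intro powr_mono) (auto simp: diff_divide_distrib intro: order_trans)
    also have "\<dots> = c powr real d"
      by (simp add: c_def powr_powr)
    finally show ?case by simp
  qed
qed

section \<open>Numerical value of \<open>c\<close>\<close>

text \<open>For a fraction p/q close to \<open>L\<close>, comparing \<open>c ^ p\<close> with 2^q
  reduces bounds on \<open>c\<close> to inequalities between rational powers.\<close>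

lemma c_power: "c ^ p = 2 powr (real p / L)"
  by (simp add: c_def powr_powr flip: powr_realpow)

text \<open>\<open>779/359\<close> lies between \<open>1 / log\<^sub>2 1.37635\<close> and \<open>log\<^sub>2 4.5\<close>.
  Rounding \<open>1.37635\<^sup>1\<^sup>9\<close> down to \<open>432.363\<close> keeps the numerals small enough for the simplifier.\<close>

lemma c_upper: "c < 1.37635"
proof (rule power_less_imp_less_base)
  have "real 779 = log 2 (2 ^ 779)"
    by (rule log_pow_cancel[symmetric]) simp_all
  also have "\<dots> < log 2 ((9/2) ^ 359)"
    by (subst log_less_cancel_iff) (simp_all add: power_divide)
  also have "\<dots> = 359 * L"
    by (simp only: log_nat_power)
  finally have "real 779 / L < 359"
    using L_pos by (simp add: pos_divide_less_eq)
  then have "c ^ 779 < 2 powr 359"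
    unfolding c_power by (intro powr_less_mono) auto
  also have "\<dots> = 2 ^ 359"
    by (simp only: powr_numeral zero_le_numeral)
  also have "\<dots> < (432.363 :: real) ^ 41"
    by (simp add: power_divide)
  also have "\<dots> \<le> (1.37635 ^ 19) ^ 41"
    by (rule power_mono) (simp_all add: power_divide)
  also have "\<dots> = 1.37635 ^ 779"
    unfolding power_mult[symmetric] by (rule arg_cong) simp
  finally show "c ^ 779 < 1.37635 ^ 779" .
qed simp

text \<open>\<open>102/47\<close> lies between \<open>log\<^sub>2 4.5\<close> and \<open>1 / log\<^sub>2 1.37625\<close>.\<close>

lemma c_lower: "c > 1.37625"
proof (rule power_less_imp_less_base)
  have "47 * L = log 2 ((9/2) ^ 47)"
    by (simp add: log_nat_power del: power_divide)
  also have "\<dots> < log 2 (2 ^ 102)"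
    by (subst log_less_cancel_iff) (simp_all add: power_divide)
  also have "\<dots> = real 102"
    by (rule log_pow_cancel) simp_all
  finally have "real 102 / L > 47"
    using L_pos by (simp add: pos_less_divide_eq)
  then have "2 powr 47 < c ^ 102"
    unfolding c_power by (intro powr_less_mono) auto
  moreover have "(1.37625 :: real) ^ 102 < 2 ^ 47"
    by (simp add: power_divide)
  ultimately show "1.37625 ^ 102 < c ^ 102"
    by simp
qed (simp add: c_def)

theorem theorem6p7:
  shows "(\<forall>\<^sub>F d in at_top. mpar d \<ge> 0 \<and> 2 * kpar d + nat (mpar d) + 1 = d)
    \<and> (\<lambda>d::nat. real (dist_size (hypercube d) (D (kpar d) (nat (mpar d)))))
        \<in> O(\<lambda>d. 2 powi (mpar d))
    \<and> (\<lambda>d::nat. 2 powi (mpar d) :: real) \<in> O(\<lambda>d. c powr real d)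
    \<and> \<bar>c - 1.3763\<bar> < 0.00005"
proof (intro conjI)
  show "\<forall>\<^sub>F d in at_top. mpar d \<ge> 0 \<and> 2 * kpar d + nat (mpar d) + 1 = d"
    using eventually_mpar_nonneg by eventually_elim (use kpar_mpar_dimension in blast)
  show "\<bar>c - 1.3763\<bar> < 0.00005"
    using c_upper c_lower unfolding abs_less_iff by simp
qed (fact dist_size_D_bigo two_powi_mpar_bigo)+

end
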